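(* All the logical rules $0,+,\times,\sqcup,\sqcap,\Diamond$ of $\mathbf{HMR}$ are CAN-free invertible in $\mathbf{HMR}$: for every instance of one of these rules, if its conclusion has a CAN-free derivation in $\mathbf{HMR}$, then each of its premises has a CAN-free derivation in $\mathbf{HMR}$.
   Context: Terms. Fix a countable set of variables $x,y,\dots$. Terms (in negation normal form) are generated by $A ::= x \mid \overline{x} \mid 0 \mid 1 \mid \overline{1} \mid A+A \mid rA \mid A\sqcup A \mid A\sqcap A \mid \Diamond A$ with $r\in\mathbb{R}_{>0}$. Negation: $\overline{x}$ for $x$, $\overline{\overline{x}}=x$, $\overline{0}=0$, $\overline 1$ for $1$, $\overline{\overline{1}}=1$, $\overline{A+B}=\overline A+\overline B$, $\overline{rA}=r\overline A$, $\overline{A\sqcup B}=\overline A\sqcap\overline B$, $\overline{A\sqcap B}=\overline A\sqcup\overline B$, $\overline{\Diamond A}=\Diamond\overline A$. A weighted term is $r.A$ ($r>0$); a sequent $\vdash\Gamma$ has $\Gamma$ a finite (possibly empty) multiset of weighted terms; a hypersequent is a nonempty finite multiset of sequents $\vdash\Gamma_1\mid\cdots\mid\vdash\Gamma_n$; $G\mid\vdash\Gamma$ adds a sequent. For a finite (possibly empty) sequence $\vec r=(r_1,\dots,r_n)$ of positive reals, $\vec r.A$ is the multiset $r_1.A,\dots,r_n.A$, $\sum\vec r=r_1+\dots+r_n$, $s\vec r=(sr_1,\dots,sr_n)$; $s.\Gamma$ multiplies all weights by $s>0$; if $\Gamma=r_1.A_1,\dots,r_n.A_n$ then $\Diamond\Gamma=r_1.\Diamond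 A_1,\dots,r_n.\Diamond A_n$. The calculus $\mathbf{HMR}$ has the rules: INIT: $\vdash$ with no premises. W: from $G$ infer $G\mid\vdash\Gamma$. C: from $G\mid\vdash\Gamma\mid\vdash\Gamma$ infer $G\mid\vdash\Gamma$. S: from $G\mid\vdash\Gamma_1,\Gamma_2$ infer $G\mid\vdash\Gamma_1\mid\vdash\Gamma_2$. M: from $G\mid\vdash\Gamma_1$ and $G\mid\vdash\Gamma_2$ infer $G\mid\vdash\Gamma_1,\Gamma_2$. T: for $r>0$, from $G\mid\vdash r.\Gamma$ infer $G\mid\vdash\Gamma$. ID: if $\sum\vec r=\sum\vec s$, from $G\mid\vdash\Gamma$ infer $G\mid\vdash\Gamma,\vec r.x,\vec s.\overline{x}$ ($x$ a variable). 0: from $G\mid\vdash\Gamma$ infer $G\mid\vdash\Gamma,\vec r.0$. $+$: from $G\mid\vdash\Gamma,\vec r.A,\vec r.B$ infer $G\mid\vdash\Gamma,\vec r.(A+B)$. $\times$: from $G\mid\vdash\Gamma,(s\vec r).A$ infer $G\mid\vdash\Gamma,\vec r.(sA)$. $\sqcup$: from $G\mid\vdash\Gamma,\vec r.A\mid\vdash\Gamma,\vec r.B$ infer $G\mid\vdash\Gamma,\vec r.(A\sqcup B)$. $\sqcap$: from $G\mid\vdash\Gamma,\vec r.A$ and $G\mid\vdash\Gamma,\vec r.B$ infer $G\mid\vdash\Gamma,\vec r.(A\sqcap B)$. CAN: if $\sum\vec r=\sum\vec s$, from $G\mid\vdash\Gamma,\vec s.A,\vec r.\overline A$ infer $G\mid\vdash\Gamma$.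 1: if $\sum\vec r\geq\sum\vec s$, from $G\mid\vdash\Gamma$ infer $G\mid\vdash\Gamma,\vec r.1,\vec s.\overline{1}$. $\Diamond$: if $\sum\vec r\geq\sum\vec s$, from the single-sequent hypersequent $\vdash\Gamma,\vec r.1,\vec s.\overline 1$ infer the single-sequent hypersequent $\vdash\Diamond\Gamma,\vec r.1,\vec s.\overline 1$. A derivation is a finite tree of rule instances whose leaves are INIT; it is CAN-free if it contains no instance of CAN. *)

theory Defs
  imports Complex_Main "HOL-Library.Multiset" "HOL-Library.Countable"
begin

typedef posreal = "{r :: real. 0 < r}"
  morphisms real_of_posreal Abs_posreal
  by (rule exI[of _ 1]) simp

setup_lifting type_definition_posreal

instantiation posreal :: ab_semigroup_mult
begin

lift_definition times_posreal :: "posreal \<Rightarrow> posreal \<Rightarrow> posreal" is "(*)"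
  by simp

instance
  by standard (transfer; simp add: mult_ac)+

end

text \<open>Terms are in negation normal form: negation is the function \<open>neg\<close>, not a constructor;
  \<open>CoVar\<close> and \<open>CoOne\<close> are the primitive negated variables and the negated constant 1.\<close>

datatype 'v hterm =
    Var 'v
  | CoVar 'v
  | Zero
  | One
  | CoOne
  | Plus "'v hterm" "'v hterm"
  | Scale posreal "'v hterm"
  | Join "'v hterm" "'v hterm"
  | Meet "'v hterm" "'v hterm"
  | Dia "'v hterm"

primrec neg :: "'v hterm \<Rightarrow> 'v hterm" where
  "neg (Var x) = CoVar x"
| "neg (CoVar x) = Var x"
| "neg Zero = Zero"
| "neg One = CoOne"
| "neg CoOne = One"
| "neg (Plus A B) = Plus (neg A) (neg B)"
| "neg (Scale r A) = Scale r (neg A)"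
| "neg (Join A B) = Meet (neg A) (neg B)"
| "neg (Meet A B) = Join (neg A) (neg B)"
| "neg (Dia A) = Dia (neg A)"

type_synonym 'v sequent = "(posreal \<times> 'v hterm) multiset"

text \<open>Hypersequents proper are nonempty. The type also contains the empty multiset, so that the side
  hypersequent \<open>G\<close> of a rule may be absent. Weakening is the only rule whose premise could then be
  the empty hypersequent, and it is guarded below.\<close>

type_synonym 'v hypersequent = "'v sequent multiset"

definition weigh :: "posreal list \<Rightarrow> 'v hterm \<Rightarrow> 'v sequent" where
  "weigh rs A = mset (map (\<lambda>r. (r, A)) rs)"

definition total :: "posreal list \<Rightarrow> real" where
  "total rs = (\<Sum>r\<leftarrow>rs. real_of_posreal r)"

definition scale_sequent :: "posreal \<Rightarrow> 'v sequent \<Rightarrow> 'v sequent" where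
  "scale_sequent s \<Gamma> = {# (s * r, A). (r, A) \<in># \<Gamma> #}"

definition dia_sequent :: "'v sequent \<Rightarrow> 'v sequent" where
  "dia_sequent \<Gamma> = {# (r, Dia A). (r, A) \<in># \<Gamma> #}"

datatype rule_name =
  R_Init | R_W | R_C | R_S | R_M | R_T | R_Id | R_Zero | R_Plus | R_Times | R_Join | R_Meet
  | R_Can | R_One | R_Dia

text \<open>\<open>hmr_rule k ps c\<close>: there is an instance of rule \<open>k\<close> with list of premises \<open>ps\<close> and
  conclusion \<open>c\<close>.\<close>

inductive hmr_rule :: "rule_name \<Rightarrow> 'v hypersequent list \<Rightarrow> 'v hypersequent \<Rightarrow> bool" where
  Init: "hmr_rule R_Init [] {# {#} #}"
| W: "G \<noteq> {#} \<Longrightarrow> hmr_rule R_W [G] (add_mset \<Gamma> G)"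
| C: "hmr_rule R_C [add_mset \<Gamma> (add_mset \<Gamma> G)] (add_mset \<Gamma> G)"
| S: "hmr_rule R_S [add_mset (\<Gamma>1 + \<Gamma>2) G] (add_mset \<Gamma>1 (add_mset \<Gamma>2 G))"
| M: "hmr_rule R_M [add_mset \<Gamma>1 G, add_mset \<Gamma>2 G] (add_mset (\<Gamma>1 + \<Gamma>2) G)"
| T: "hmr_rule R_T [add_mset (scale_sequent r \<Gamma>) G] (add_mset \<Gamma> G)"
| Id: "total rs = total ss \<Longrightarrow>
    hmr_rule R_Id [add_mset \<Gamma> G] (add_mset (\<Gamma> + weigh rs (Var x) + weigh ss (CoVar x)) G)"
| Zero: "hmr_rule R_Zero [add_mset \<Gamma> G] (add_mset (\<Gamma> + weigh rs Zero) G)"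
| Plus: "hmr_rule R_Plus [add_mset (\<Gamma> + weigh rs A + weigh rs B) G]
    (add_mset (\<Gamma> + weigh rs (Plus A B)) G)"
| Times: "hmr_rule R_Times [add_mset (\<Gamma> + weigh (map ((*) s) rs) A) G]
    (add_mset (\<Gamma> + weigh rs (Scale s A)) G)"
| Join: "hmr_rule R_Join [add_mset (\<Gamma> + weigh rs A) (add_mset (\<Gamma> + weigh rs B) G)]
    (add_mset (\<Gamma> + weigh rs (Join A B)) G)"
| Meet: "hmr_rule R_Meet [add_mset (\<Gamma> + weigh rs A) G, add_mset (\<Gamma> + weigh rs B) G]
    (add_mset (\<Gamma> + weigh rs (Meet A B)) G)"
| Can: "total rs = total ss \<Longrightarrow>
    hmr_rule R_Can [add_mset (\<Gamma> + weigh ss A + weigh rs (neg A)) G] (add_mset \<Gamma> G)"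
| One: "total rs \<ge> total ss \<Longrightarrow>
    hmr_rule R_One [add_mset \<Gamma> G] (add_mset (\<Gamma> + weigh rs One + weigh ss CoOne) G)"
| Dia: "total rs \<ge> total ss \<Longrightarrow>
    hmr_rule R_Dia [{# \<Gamma> + weigh rs One + weigh ss CoOne #}]
      {# dia_sequent \<Gamma> + weigh rs One + weigh ss CoOne #}"

text \<open>\<open>derivable K c\<close>: \<open>c\<close> is the root of a finite tree of instances of rules from \<open>K\<close>. Leaves need no
  separate clause, since \<open>R_Init\<close> is the only rule without premises.\<close>

inductive derivable :: "rule_name set \<Rightarrow> 'v hypersequent \<Rightarrow> bool" for K where
  node: "k \<in> K \<Longrightarrow> hmr_rule k ps c \<Longrightarrow> (\<forall>p \<in> set ps. derivable K p) \<Longrightarrow> derivable K c"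

definition can_free_derivable :: "'v hypersequent \<Rightarrow> bool" where
  "can_free_derivable c \<longleftrightarrow> derivable (UNIV - {R_Can}) c"

definition logical_rules :: "rule_name set" where
  "logical_rules = {R_Zero, R_Plus, R_Times, R_Join, R_Meet, R_Dia}"

end

theory Submission
  imports Defs "HOL-Library.Function_Algebras" "HOL-Analysis.Convex"
begin

text \<open>Terms are interpreted in the real vector space of functions on terms, in which the variables,
  1 and the terms \<open>\<diamond>A\<close> are independent unit vectors. A convex cone \<open>T\<close> with \<open>T \<union> -T\<close> everything is
  a total preorder on this space, so joins and meets become maxima and minima. A hypersequent is valid
  if, for every such \<open>T\<close> that contains the values of all conclusions of \<open>\<diamond>\<close> with CAN-free derivable
  premise, one of its sequents has its value in \<open>T\<close>. Soundness is then immediate, and so is the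
  preservation of validity from conclusion to premises of \<open>0, +, \<times>, \<squnion>, \<sqinter>\<close>. For completeness,
  decomposing terms leaves hypersequents without outer connectives. If no convex combination of the
  components lay in the cone generated by the conclusions of \<open>\<diamond>\<close>, Zorn's lemma would extend this cone
  to a total one refuting validity; so some combination does, and it is derivable by induction on
  the modal depth. Since the values only depend on total weights, no merging of weights is ever
  needed at the level of derivations.\<close>

section \<open>Total cones\<close>

instantiation "fun" :: (type, real_vector) real_vector
begin

definition scaleR_fun :: "real \<Rightarrow> ('a \<Rightarrow> 'b) \<Rightarrow> 'a \<Rightarrow> 'b" where
  "scaleR_fun c f = (\<lambda>x. c *\<^sub>R f x)"

instance
  by standard (auto simp: scaleR_fun_def fun_eq_iff scaleR_add_right scaleR_add_left)

end

lemma scaleR_fun_apply: "(c *\<^sub>R f) x = c *\<^sub>R f x"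
  by (simp add: scaleR_fun_def)

text \<open>Values are handled as vectors; evaluation at a coordinate happens only on request,
  mostly through \<open>pointwise\<close>.\<close>

declare plus_fun_apply [simp del] zero_fun_apply [simp del]

definition total_cone :: "'a::real_vector set \<Rightarrow> bool" where
  "total_cone T \<longleftrightarrow> convex_cone T \<and> (\<forall>x. x \<in> T \<or> - x \<in> T)"

text \<open>Otherwise \<open>- y \<in> T\<close>, and adding it to \<open>x + y\<close> would give
  \<open>x \<in> T\<close>. This yields the soundness of the rule S.\<close>

lemma total_cone_split:
  assumes "total_cone T" "x + y \<in> T"
  shows "x \<in> T \<or> y \<in> T"
proof (rule ccontr)
  assume *: "\<not> (x \<in> T \<or> y \<in> T)"
  then have "- y \<in> T"
    using assms(1) by (auto simp: total_cone_def)
  then have "(x + y) + - y \<in> T"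
    using assms convex_cone_add unfolding total_cone_def by blast
  with * show False
    by simp
qed

text \<open>A maximal cone that contains \<open>K\<close> and misses \<open>S\<close> is total: if
  it contained neither \<open>x\<close> nor \<open>- x\<close>, enlarging it by either would reach
  \<open>S\<close>, and a convex combination of the two points reached cancels \<open>x\<close>, so
  it lies in both \<open>T\<close> and \<open>S\<close>.\<close>

lemma exists_total_cone_disjoint:
  assumes K: "convex_cone K" and S: "convex S" and disj: "K \<inter> S = {}"
  shows "\<exists>T. total_cone T \<and> K \<subseteq> T \<and> T \<inter> S = {}"
proof -
  define \<A> where "\<A> = {T. convex_cone T \<and> K \<subseteq> T \<and> T \<inter> S = {}}"
  have "\<exists>M\<in>\<A>. \<forall>X\<in>\<A>. M \<subseteq> X \<longrightarrow> X = M"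
  proof (rule subset_Zorn_nonempty)
    show "\<A> \<noteq> {}"
      using K disj by (auto simp: \<A>_def)
    show "\<Union>\<C> \<in> \<A>" if ne: "\<C> \<noteq> {}" and ch: "subset.chain \<A> \<C>" for \<C>
    proof -
      have sub: "\<C> \<subseteq> \<A>"
        using ch by (auto simp: subset_chain_def)
      have "x + y \<in> \<Union>\<C>" if "x \<in> \<Union>\<C>" "y \<in> \<Union>\<C>" for x y
      proof -
        from that obtain X Y where XY: "X \<in> \<C>" "Y \<in> \<C>" "x \<in> X" "y \<in> Y"
          by blast
        then have "X \<subseteq> Y \<or> Y \<subseteq> X"
          using ch by (auto simp: subset_chain_def)
        then obtain Z where "Z \<in> \<C>" "x \<in> Z" "y \<in> Z"
          using XY by blast
        then show ?thesis
          using sub by (auto simp: \<A>_def intro: convex_cone_add)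
      qed
      moreover have "c *\<^sub>R x \<in> \<Union>\<C>" if "x \<in> \<Union>\<C>" "0 \<le> c" for c x
        using that sub by (auto simp: \<A>_def intro: convex_cone_scaleR)
      moreover have "0 \<in> \<Union>\<C>"
        using sub ne by (auto simp: \<A>_def intro: convex_cone_contains_0)
      ultimately have "convex_cone (\<Union>\<C>)"
        by (auto simp: convex_cone_iff)
      then show ?thesis
        using sub ne by (auto simp: \<A>_def)
    qed
  qed
  then obtain T where T: "convex_cone T" "K \<subseteq> T" "T \<inter> S = {}"
    and max: "\<And>X. convex_cone X \<Longrightarrow> K \<subseteq> X \<Longrightarrow> X \<inter> S = {} \<Longrightarrow> T \<subseteq> X \<Longrightarrow> X = T"
    by (auto simp: \<A>_def)
  \<comment> \<open>By maximality the cone \<open>X\<close> generated by \<open>T\<close> and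
    \<open>x\<close> meets \<open>S\<close>; the coefficient of \<open>x\<close> at a common point
    is nonzero because \<open>T\<close> misses \<open>S\<close>.\<close>
  have meets: "\<exists>a\<in>T. \<exists>p>0. a + p *\<^sub>R x \<in> S" if "x \<notin> T" for x
  proof -
    define X where "X = {a + p *\<^sub>R x |a p. a \<in> T \<and> 0 \<le> p}"
    have TX: "T \<subseteq> X"
    proof
      fix a assume "a \<in> T"
      then have "a = a + 0 *\<^sub>R x \<and> a \<in> T \<and> 0 \<le> (0::real)"
        by simp
      then show "a \<in> X"
        unfolding X_def by blast
    qed
    have "x \<in> X"
      unfolding X_def using convex_cone_contains_0[OF T(1)]
      by (intro CollectI exI[of _ 0] exI[of _ 1]) simp
    have "u + v \<in> X" if "u \<in> X" "v \<in> X" for u v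
    proof -
      from that obtain a p b q where
        "u = a + p *\<^sub>R x" "a \<in> T" "0 \<le> p" "v = b + q *\<^sub>R x" "b \<in> T" "0 \<le> q"
        unfolding X_def by blast
      moreover from this have "u + v = (a + b) + (p + q) *\<^sub>R x"
        by (simp add: scaleR_add_left)
      ultimately show ?thesis
        unfolding X_def
        by (intro CollectI exI[of _ "a + b"] exI[of _ "p + q"]) (simp add: convex_cone_add[OF T(1)])
    qed
    moreover have "c *\<^sub>R u \<in> X" if "u \<in> X" "0 \<le> c" for c u
    proof -
      from that obtain a p where "u = a + p *\<^sub>R x" "a \<in> T" "0 \<le> p"
        unfolding X_def by blast
      moreover from this have "c *\<^sub>R u = c *\<^sub>R a + (c * p) *\<^sub>R x"
        by (simp add: scaleR_add_right)
      ultimately show ?thesis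
        unfolding X_def using that(2)
        by (intro CollectI exI[of _ "c *\<^sub>R a"] exI[of _ "c * p"]) (simp add: convex_cone_scaleR[OF T(1)])
    qed
    ultimately have "convex_cone X"
      using TX convex_cone_contains_0[OF T(1)] by (auto simp: convex_cone_iff)
    then have "X \<inter> S \<noteq> {}"
      using max TX T(2) \<open>x \<in> X\<close> that by blast
    then obtain a p where ap: "a \<in> T" "0 \<le> p" "a + p *\<^sub>R x \<in> S"
      unfolding X_def by blast
    moreover have "p \<noteq> 0"
      using ap T(3) by auto
    ultimately show ?thesis
      by (intro bexI[of _ a] exI[of _ p]) auto
  qed
  have "x \<in> T \<or> - x \<in> T" for x
  proof (rule ccontr)
    assume "\<not> (x \<in> T \<or> - x \<in> T)"
    then obtain a p b q where ap: "a \<in> T" "p > 0" "a + p *\<^sub>R x \<in> S"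
      and bq: "b \<in> T" "q > 0" "b + q *\<^sub>R (- x) \<in> S"
      using meets by meson
    \<comment> \<open>The weights solve \<open>u * p = v * q\<close>, which makes the multiples of
      \<open>x\<close> cancel.\<close>
    define u v where "u = q / (p + q)" and "v = p / (p + q)"
    have uv: "0 \<le> u" "0 \<le> v" "u + v = 1" "u * p = v * q"
      using ap(2) bq(2) by (simp_all add: u_def v_def add_divide_distrib[symmetric] add.commute)
    have "u *\<^sub>R (a + p *\<^sub>R x) + v *\<^sub>R (b + q *\<^sub>R (- x)) \<in> S"
      using convexD[OF S ap(3) bq(3) uv(1,2,3)] .
    moreover have "u *\<^sub>R (a + p *\<^sub>R x) + v *\<^sub>R (b + q *\<^sub>R (- x)) = u *\<^sub>R a + v *\<^sub>R b"
      by (simp add: scaleR_add_right scaleR_diff_right uv(4))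
    moreover have "u *\<^sub>R a + v *\<^sub>R b \<in> T"
      using T(1) ap(1) bq(1) uv by (intro convex_cone_add convex_cone_scaleR)
    ultimately show False
      using T(3) by auto
  qed
  then show ?thesis
    using T unfolding total_cone_def by blast
qed

section \<open>Weights and scaling\<close>

lemma can_free_derivable_rule:
  assumes "hmr_rule k ps c" "k \<noteq> R_Can" "\<And>p. p \<in> set ps \<Longrightarrow> can_free_derivable p"
  shows "can_free_derivable c"
  using assms unfolding can_free_derivable_def by (intro derivable.node) auto

lemma mix_rule:
  assumes "can_free_derivable (add_mset \<Gamma> G)" "can_free_derivable (add_mset \<Delta> G)"
  shows "can_free_derivable (add_mset (\<Gamma> + \<Delta>) G)"
  using assms by (intro can_free_derivable_rule[OF hmr_rule.M]) auto

lemmas init_rule = can_free_derivable_rule[OF hmr_rule.Init, simplified]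
  and weakening = can_free_derivable_rule[OF hmr_rule.W, simplified]
  and contraction = can_free_derivable_rule[OF hmr_rule.C, simplified]
  and split_rule = can_free_derivable_rule[OF hmr_rule.S, simplified]
  and time_rule = can_free_derivable_rule[OF hmr_rule.T, simplified]
  and id_rule = can_free_derivable_rule[OF hmr_rule.Id, simplified]
  and one_rule = can_free_derivable_rule[OF hmr_rule.One, simplified]
  and dia_rule = can_free_derivable_rule[OF hmr_rule.Dia, simplified]

lemma weakening_multi:
  assumes "can_free_derivable G" "G \<noteq> {#}"
  shows "can_free_derivable (G + H)"
  using assms by (induction H) (simp_all add: weakening)

lemma contraction_multi:
  assumes "can_free_derivable (G + H + H)"
  shows "can_free_derivable (G + H)"
  using assms
proof (induction H arbitrary: G)
  case (add \<Gamma> H)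
  have "can_free_derivable (add_mset \<Gamma> (add_mset \<Gamma> (G + H + H)))"
    using add.prems by simp
  then have "can_free_derivable (add_mset \<Gamma> G + H + H)"
    using contraction by fastforce
  from add.IH[OF this] show ?case
    by simp
qed simp

lemma real_of_posreal_pos [simp]: "0 < real_of_posreal r"
  using real_of_posreal[of r] by simp

lemma real_of_posreal_nonneg [simp]: "0 \<le> real_of_posreal r"
  using real_of_posreal_pos[of r] by linarith

lemma real_of_posreal_times [simp]: "real_of_posreal (r * s) = real_of_posreal r * real_of_posreal s"
  by transfer simp

lemma obtain_posreal:
  assumes "0 < a"
  obtains r where "real_of_posreal r = a"
  using assms Abs_posreal_inverse[of a] by auto

lemma weigh_Nil [simp]: "weigh [] A = {#}"
  and weigh_Cons [simp]: "weigh (r # rs) A = add_mset (r, A) (weigh rs A)"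
  and weigh_append: "weigh (rs @ ss) A = weigh rs A + weigh ss A"
  by (simp_all add: weigh_def)

lemma total_Nil [simp]: "total [] = 0"
  and total_Cons [simp]: "total (r # rs) = real_of_posreal r + total rs"
  and total_append [simp]: "total (rs @ ss) = total rs + total ss"
  by (simp_all add: total_def)

lemma total_scaled [simp]: "total (map ((*) s) rs) = real_of_posreal s * total rs"
  by (induction rs) (auto simp: distrib_left)

lemma total_nonneg [simp]: "0 \<le> total rs"
  by (induction rs) auto

lemma scale_sequent_simps [simp]:
  "scale_sequent s {#} = {#}"
  "scale_sequent s (add_mset (r, A) \<Gamma>) = add_mset (s * r, A) (scale_sequent s \<Gamma>)"
  "scale_sequent s (\<Gamma> + \<Delta>) = scale_sequent s \<Gamma> + scale_sequent s \<Delta>"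
  "scale_sequent s (weigh rs A) = weigh (map ((*) s) rs) A"
  by (simp_all add: scale_sequent_def weigh_def image_mset.compositionality comp_def)

lemma dia_sequent_simps [simp]:
  "dia_sequent {#} = {#}"
  "dia_sequent (add_mset (r, A) \<Gamma>) = add_mset (r, Dia A) (dia_sequent \<Gamma>)"
  "dia_sequent (\<Gamma> + \<Delta>) = dia_sequent \<Gamma> + dia_sequent \<Delta>"
  by (simp_all add: dia_sequent_def)

lemma scale_dia_sequent: "scale_sequent s (dia_sequent \<Gamma>) = dia_sequent (scale_sequent s \<Gamma>)"
  by (induction \<Gamma>) auto

lemma scale_sequent_inverse:
  assumes "real_of_posreal s * real_of_posreal r = 1"
  shows "scale_sequent s (scale_sequent r \<Gamma>) = \<Gamma>"
proof (induction \<Gamma>)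
  case (add p \<Gamma>)
  obtain q A where p: "p = (q, A)"
    by force
  have "real_of_posreal (s * (r * q)) = real_of_posreal q"
    using assms by (simp add: mult.assoc[symmetric] del: mult_cancel_right1)
  then have "s * (r * q) = q"
    by (simp only: real_of_posreal_inject)
  then show ?case
    using add by (simp add: p)
qed simp

text \<open>T deletes a factor from its premise, so a factor \<open>r\<close> is introduced by
  applying T with factor \<open>1 / r\<close>.\<close>

lemma derivable_scale_sequent:
  assumes "can_free_derivable (add_mset \<Gamma> G)"
  shows "can_free_derivable (add_mset (scale_sequent r \<Gamma>) G)"
proof -
  obtain s where "real_of_posreal s = 1 / real_of_posreal r"
    using obtain_posreal[of "1 / real_of_posreal r"] by auto
  then have "real_of_posreal s * real_of_posreal r = 1"
    by (simp add: less_imp_neq[OF real_of_posreal_pos, symmetric])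
  then have "can_free_derivable (add_mset (scale_sequent s (scale_sequent r \<Gamma>)) G)"
    using assms by (simp add: scale_sequent_inverse)
  then show ?thesis
    by (rule time_rule)
qed

section \<open>Validity and soundness\<close>

definition unit_at :: "'a \<Rightarrow> 'a \<Rightarrow> real" where
  "unit_at a = (\<lambda>x. if x = a then 1 else 0)"

lemma unit_at_apply: "unit_at a x = (if x = a then 1 else 0)"
  by (simp add: unit_at_def)

text \<open>\<open>val T B - val T A \<in> T\<close> says that \<open>A\<close> is below
  \<open>B\<close> in the preorder of \<open>T\<close>. The preorder serves only to choose between
  the arguments of a join or a meet, and a term under a modality is not evaluated: each
  \<open>Dia A\<close> is a coordinate of its own.\<close>

primrec val :: "('v hterm \<Rightarrow> real) set \<Rightarrow> 'v hterm \<Rightarrow> 'v hterm \<Rightarrow> real" where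
  "val T (Var x) = unit_at (Var x)"
| "val T (CoVar x) = - unit_at (Var x)"
| "val T Zero = 0"
| "val T One = unit_at One"
| "val T CoOne = - unit_at One"
| "val T (Plus A B) = val T A + val T B"
| "val T (Scale r A) = real_of_posreal r *\<^sub>R val T A"
| "val T (Join A B) = (if val T B - val T A \<in> T then val T B else val T A)"
| "val T (Meet A B) = (if val T B - val T A \<in> T then val T A else val T B)"
| "val T (Dia A) = unit_at (Dia A)"

definition sval :: "('v hterm \<Rightarrow> real) set \<Rightarrow> 'v sequent \<Rightarrow> 'v hterm \<Rightarrow> real" where
  "sval T \<Gamma> = (\<Sum>(r, A)\<in>#\<Gamma>. real_of_posreal r *\<^sub>R val T A)"

lemma sval_simps [simp]:
  "sval T {#} = 0"
  "sval T (add_mset (r, A) \<Gamma>) = real_of_posreal r *\<^sub>R val T A + sval T \<Gamma>"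
  "sval T (\<Gamma> + \<Delta>) = sval T \<Gamma> + sval T \<Delta>"
  by (simp_all add: sval_def)

lemma sval_weigh [simp]: "sval T (weigh rs A) = total rs *\<^sub>R val T A"
  by (induction rs) (simp_all add: scaleR_add_left)

lemma sval_scale [simp]: "sval T (scale_sequent s \<Gamma>) = real_of_posreal s *\<^sub>R sval T \<Gamma>"
proof (induction \<Gamma>)
  case (add p \<Gamma>)
  then show ?case
    by (cases p) (simp add: scaleR_add_right)
qed simp

text \<open>A premise of the rule \<diamond> with its side condition, divided into the part
  \<open>\<Gamma>\<close> that receives modalities and the part \<open>\<Delta>\<close> that the
  rule copies.\<close>

definition modal_premise :: "'v sequent \<Rightarrow> 'v sequent \<Rightarrow> bool" where
  "modal_premise \<Gamma> \<Delta> \<longleftrightarrow> (\<exists>rs ss. total ss \<le> total rs \<and> \<Delta> = weigh rs One + weigh ss CoOne \<and>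
    can_free_derivable {# \<Gamma> + \<Delta> #})"

text \<open>The choice of the parameter \<open>{}\<close> of \<open>sval\<close> is immaterial here, since these sequents contain no
  lattice connective outside a modality.\<close>

definition modal_cone :: "('v hterm \<Rightarrow> real) set" where
  "modal_cone = {sval {} (dia_sequent \<Gamma> + \<Delta>) |\<Gamma> \<Delta>. modal_premise \<Gamma> \<Delta>}"

definition valid :: "'v hypersequent \<Rightarrow> bool" where
  "valid H \<longleftrightarrow> (\<forall>T. total_cone T \<longrightarrow> modal_cone \<subseteq> T \<longrightarrow> (\<exists>\<Gamma>\<in>#H. sval T \<Gamma> \<in> T))"

lemma sval_dia_sequent: "sval T (dia_sequent \<Gamma>) = sval {} (dia_sequent \<Gamma>)"
proof (induction \<Gamma>)
  case (add p \<Gamma>)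
  then show ?case
    by (cases p) simp
qed simp

lemma modal_premise_add:
  assumes "modal_premise \<Gamma> \<Delta>" "modal_premise \<Gamma>' \<Delta>'"
  shows "modal_premise (\<Gamma> + \<Gamma>') (\<Delta> + \<Delta>')"
proof -
  from assms obtain rs ss rs' ss' where *:
    "total ss \<le> total rs" "\<Delta> = weigh rs One + weigh ss CoOne" "can_free_derivable {# \<Gamma> + \<Delta> #}"
    "total ss' \<le> total rs'" "\<Delta>' = weigh rs' One + weigh ss' CoOne" "can_free_derivable {# \<Gamma>' + \<Delta>' #}"
    unfolding modal_premise_def by blast
  have "can_free_derivable {# (\<Gamma> + \<Delta>) + (\<Gamma>' + \<Delta>') #}"
    using *(3,6) by (rule mix_rule)
  then show ?thesis
    unfolding modal_premise_def using *(1,2,4,5)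
    by (intro exI[of _ "rs @ rs'"] exI[of _ "ss @ ss'"]) (simp add: weigh_append ac_simps)
qed

lemma modal_premise_scale:
  assumes "modal_premise \<Gamma> \<Delta>"
  shows "modal_premise (scale_sequent r \<Gamma>) (scale_sequent r \<Delta>)"
proof -
  from assms obtain rs ss where *:
    "total ss \<le> total rs" "\<Delta> = weigh rs One + weigh ss CoOne" "can_free_derivable {# \<Gamma> + \<Delta> #}"
    unfolding modal_premise_def by blast
  from derivable_scale_sequent[OF *(3), of r] *(1,2) show ?thesis
    unfolding modal_premise_def
    by (intro exI[of _ "map ((*) r) rs"] exI[of _ "map ((*) r) ss"]) (simp add: mult_left_mono)
qed

text \<open>Zero comes from INIT, sums from the rule M and positive multiples from the rule T, each
  applied to premises of \<diamond>.\<close>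

lemma convex_cone_modal_cone: "convex_cone (modal_cone :: ('v hterm \<Rightarrow> real) set)"
proof -
  have "modal_premise {#} ({#} :: 'v sequent)"
    unfolding modal_premise_def using init_rule by (intro exI[of _ "[]"]) simp
  then have "sval {} (dia_sequent {#} + {#}) \<in> (modal_cone :: ('v hterm \<Rightarrow> real) set)"
    unfolding modal_cone_def by blast
  then have zero: "0 \<in> (modal_cone :: ('v hterm \<Rightarrow> real) set)"
    by simp
  moreover have "f + g \<in> modal_cone" if fg: "f \<in> modal_cone" "g \<in> modal_cone"
    for f g :: "'v hterm \<Rightarrow> real"
  proof -
    from fg obtain \<Gamma> \<Delta> \<Gamma>' \<Delta>' where *: "f = sval {} (dia_sequent \<Gamma> + \<Delta>)" "modal_premise \<Gamma> \<Delta>"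
      "g = sval {} (dia_sequent \<Gamma>' + \<Delta>')" "modal_premise \<Gamma>' \<Delta>'"
      unfolding modal_cone_def by blast
    then have "f + g = sval {} (dia_sequent (\<Gamma> + \<Gamma>') + (\<Delta> + \<Delta>'))"
      by (simp add: ac_simps)
    then show ?thesis
      unfolding modal_cone_def using modal_premise_add[OF *(2,4)] by blast
  qed
  moreover have "c *\<^sub>R f \<in> modal_cone" if f: "f \<in> modal_cone" and c: "0 \<le> c"
    for f :: "'v hterm \<Rightarrow> real" and c
  proof (cases "c = 0")
    case False
    with c obtain r where r: "real_of_posreal r = c"
      using obtain_posreal[of c] by auto
    from f obtain \<Gamma> \<Delta> where *: "f = sval {} (dia_sequent \<Gamma> + \<Delta>)" "modal_premise \<Gamma> \<Delta>"
      unfolding modal_cone_def by blast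
    then have "c *\<^sub>R f = sval {} (dia_sequent (scale_sequent r \<Gamma>) + scale_sequent r \<Delta>)"
      by (simp add: r scale_dia_sequent[symmetric] scaleR_add_right)
    then show ?thesis
      unfolding modal_cone_def using modal_premise_scale[OF *(2)] by blast
  qed (use zero in simp)
  ultimately show ?thesis
    by (auto simp: convex_cone_iff)
qed

lemma sval_in_modal_cone:
  assumes "total ss \<le> total rs" "can_free_derivable {# \<Gamma> + weigh rs One + weigh ss CoOne #}"
  shows "sval {} (dia_sequent \<Gamma> + weigh rs One + weigh ss CoOne) \<in> modal_cone"
proof -
  have "modal_premise \<Gamma> (weigh rs One + weigh ss CoOne)"
    using assms unfolding modal_premise_def by (auto simp: add.assoc)
  then show ?thesis
    unfolding modal_cone_def add.assoc by blast
qed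

lemma one_in_modal_cone:
  assumes "0 \<le> c"
  shows "c *\<^sub>R unit_at One \<in> (modal_cone :: ('v hterm \<Rightarrow> real) set)"
proof (cases "c = 0")
  case True
  then show ?thesis
    using convex_cone_contains_0[OF convex_cone_modal_cone] by simp
next
  case False
  with assms obtain r where r: "real_of_posreal r = c"
    using obtain_posreal[of c] by auto
  have "can_free_derivable {# {#} + weigh [r] One + weigh [] CoOne :: 'v sequent #}"
    using init_rule by (intro one_rule) simp_all
  from sval_in_modal_cone[OF _ this]
  have "sval {} (weigh [r] One) \<in> (modal_cone :: ('v hterm \<Rightarrow> real) set)"
    by (simp del: weigh_Cons sval_weigh)
  with r show ?thesis
    by simp
qed

theorem soundness:
  fixes H :: "'v hypersequent"
  assumes "can_free_derivable H"
  shows "valid H"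
  using assms unfolding can_free_derivable_def
proof (induction rule: derivable.induct)
  case (node k ps c)
  show ?case
    unfolding valid_def
  proof (intro allI impI)
    fix T :: "('v hterm \<Rightarrow> real) set"
    assume T: "total_cone T" "modal_cone \<subseteq> T"
    have prem: "\<exists>\<Gamma>\<in>#p. sval T \<Gamma> \<in> T" if "p \<in> set ps" for p
      using node.IH T that unfolding valid_def by blast
    have cone: "convex_cone T"
      using T(1) by (simp add: total_cone_def)
    note add_T = convex_cone_add[OF cone] and scale_T = convex_cone_scaleR[OF cone]
    from node.hyps(2) prem show "\<exists>\<Gamma>\<in>#c. sval T \<Gamma> \<in> T"
    proof cases
      case Init
      then show ?thesis
        using convex_cone_contains_0[OF cone] by simp
    next
      case (S \<Gamma>1 \<Gamma>2 G)
      then show ?thesis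
        using prem total_cone_split[OF T(1)] by auto
    next
      case (M \<Gamma>1 G \<Gamma>2)
      then show ?thesis
        using prem[of "add_mset \<Gamma>1 G"] prem[of "add_mset \<Gamma>2 G"] by (auto intro: add_T)
    next
      case (T r \<Gamma> G)
      have "sval T \<Gamma> \<in> T" if "real_of_posreal r *\<^sub>R sval T \<Gamma> \<in> T"
        using scale_T[OF _ that, of "1 / real_of_posreal r"]
        by (simp add: less_imp_neq[OF real_of_posreal_pos, symmetric])
      with T show ?thesis
        using prem by auto
    next
      case (Join \<Gamma> rs A B G)
      have le: "val T (Join A B) - val T A \<in> T" "val T (Join A B) - val T B \<in> T"
        using T(1) convex_cone_contains_0[OF cone]
        by (auto simp: total_cone_def minus_diff_eq dest: spec[of _ "val T B - val T A"])
      \<comment> \<open>The join dominates both arguments and \<open>total rs\<close> is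
        nonnegative, so replacing an argument by the join adds an element of
        \<open>T\<close>.\<close>
      have up: "sval T (\<Gamma> + weigh rs (Join A B)) \<in> T"
        if "sval T (\<Gamma> + weigh rs D) \<in> T" "val T (Join A B) - val T D \<in> T" for D
        using add_T[OF that(1) scale_T[OF _ that(2), of "total rs"]]
        by (simp add: scaleR_diff_right del: val.simps)
      from up[OF _ le(1)] up[OF _ le(2)] show ?thesis
        using Join prem by (auto simp del: val.simps sval_simps(3))
    next
      case (Meet \<Gamma> rs A G B)
      then show ?thesis
        using prem[of "add_mset (\<Gamma> + weigh rs A) G"] prem[of "add_mset (\<Gamma> + weigh rs B) G"]
        by auto
    next
      case (One rs ss \<Gamma> G)
      have "(total rs - total ss) *\<^sub>R unit_at One \<in> T"
        using one_in_modal_cone[of "total rs - total ss"] One T(2) by auto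
      from add_T[OF _ this, of "sval T \<Gamma>"] One prem show ?thesis
        by (auto simp: scaleR_diff_left add_diff_eq)
    next
      \<comment> \<open>The value of the conclusion is in \<open>modal_cone\<close> because the
        premise is derivable; the induction supplies this derivability along with validity.\<close>
      case (Dia rs ss \<Gamma>)
      have "can_free_derivable {# \<Gamma> + weigh rs One + weigh ss CoOne #}"
        using node.IH Dia by (simp add: can_free_derivable_def)
      then show ?thesis
        using sval_in_modal_cone[of ss rs \<Gamma>] sval_dia_sequent[of T \<Gamma>] Dia T(2)
        by auto
    \<comment> \<open>Among the remaining rules CAN is excluded, W and C only alter the collection
      of components, and ID, 0, + and \<times> leave the values unchanged.\<close>
    qed (use prem node.hyps(1) in \<open>auto simp: scaleR_add_right add.assoc mult.commute\<close>)
  qed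
qed

text \<open>For 0, + and \<times> the values in premise and conclusion agree. A join takes the value
  of one of its arguments, so one of the two new components inherits the value of the old one. A
  meet lies below both arguments, so both premises follow.\<close>

lemma valid_premise:
  fixes c :: "'v hypersequent"
  assumes "hmr_rule k ps c" "k \<in> {R_Zero, R_Plus, R_Times, R_Join, R_Meet}" "valid c" "p \<in> set ps"
  shows "valid p"
  unfolding valid_def
proof (intro allI impI)
  fix T :: "('v hterm \<Rightarrow> real) set"
  assume T: "total_cone T" "modal_cone \<subseteq> T"
  then have conc: "\<exists>\<Gamma>\<in>#c. sval T \<Gamma> \<in> T"
    using assms(3) unfolding valid_def by blast
  have cone: "convex_cone T"
    using T(1) by (simp add: total_cone_def)
  note add_T = convex_cone_add[OF cone] and scale_T = convex_cone_scaleR[OF cone]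
  from assms(1) show "\<exists>\<Gamma>\<in>#p. sval T \<Gamma> \<in> T"
  proof cases
    case (Meet \<Gamma> rs A G B)
    have le: "val T A - val T (Meet A B) \<in> T" "val T B - val T (Meet A B) \<in> T"
      using T(1) convex_cone_contains_0[OF cone]
      by (auto simp: total_cone_def minus_diff_eq dest: spec[of _ "val T B - val T A"])
    have down: "sval T (\<Gamma> + weigh rs D) \<in> T"
      if "sval T (\<Gamma> + weigh rs (Meet A B)) \<in> T" "val T D - val T (Meet A B) \<in> T" for D
      using add_T[OF that(1) scale_T[OF _ that(2), of "total rs"]]
      by (simp add: scaleR_diff_right del: val.simps)
    from down[OF _ le(1)] down[OF _ le(2)] show ?thesis
      using Meet conc assms(4) by (auto simp del: val.simps sval_simps(3))
  qed (use conc assms(2,4) in \<open>auto simp: scaleR_add_right add.assoc mult.commute split: if_splits\<close>)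
qed

section \<open>Completeness\<close>

primrec modal_depth :: "'v hterm \<Rightarrow> nat" where
  "modal_depth (Var x) = 0"
| "modal_depth (CoVar x) = 0"
| "modal_depth Zero = 0"
| "modal_depth One = 0"
| "modal_depth CoOne = 0"
| "modal_depth (Plus A B) = max (modal_depth A) (modal_depth B)"
| "modal_depth (Scale r A) = modal_depth A"
| "modal_depth (Join A B) = max (modal_depth A) (modal_depth B)"
| "modal_depth (Meet A B) = max (modal_depth A) (modal_depth B)"
| "modal_depth (Dia A) = Suc (modal_depth A)"

text \<open>Counts the occurrences outside modalities that the rules 0, +, \<times>, \<squnion> and
  \<sqinter> can remove, hence 1 for \<open>Zero\<close> and 0 for \<open>Dia A\<close> whatever
  \<open>A\<close> is.\<close>

primrec rank :: "'v hterm \<Rightarrow> nat" where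
  "rank (Var x) = 0"
| "rank (CoVar x) = 0"
| "rank Zero = 1"
| "rank One = 0"
| "rank CoOne = 0"
| "rank (Plus A B) = Suc (rank A + rank B)"
| "rank (Scale r A) = Suc (rank A)"
| "rank (Join A B) = Suc (rank A + rank B)"
| "rank (Meet A B) = Suc (rank A + rank B)"
| "rank (Dia A) = 0"

definition depth_le :: "nat \<Rightarrow> 'v sequent \<Rightarrow> bool" where
  "depth_le n \<Gamma> \<longleftrightarrow> (\<forall>p\<in>#\<Gamma>. modal_depth (snd p) \<le> n)"

lemma depth_le_simps [simp]:
  "depth_le n {#}"
  "depth_le n (add_mset p \<Gamma>) \<longleftrightarrow> modal_depth (snd p) \<le> n \<and> depth_le n \<Gamma>"
  "depth_le n (\<Gamma> + \<Delta>) \<longleftrightarrow> depth_le n \<Gamma> \<and> depth_le n \<Delta>"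
  by (auto simp: depth_le_def)

lemma depth_le_weigh: "modal_depth A \<le> n \<Longrightarrow> depth_le n (weigh rs A)"
  by (induction rs) auto

lemma depth_le_scale [simp]: "depth_le n (scale_sequent r \<Gamma>) \<longleftrightarrow> depth_le n \<Gamma>"
  by (induction \<Gamma>) auto

lemma depth_le_dia_Suc: "depth_le (Suc n) (dia_sequent \<Gamma>) \<longleftrightarrow> depth_le n \<Gamma>"
  by (induction \<Gamma>) auto

lemma depth_le_dia_0: "depth_le 0 (dia_sequent \<Gamma>) \<longleftrightarrow> \<Gamma> = {#}"
  by (cases \<Gamma>) auto

lemma depth_le_bound: "\<exists>n. \<forall>\<Gamma>\<in>#H. depth_le n \<Gamma>"
proof -
  have "finite (\<Union>\<Gamma>\<in>set_mset H. (modal_depth \<circ> snd) ` set_mset \<Gamma>)"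
    by simp
  then obtain n where "\<forall>k\<in>(\<Union>\<Gamma>\<in>set_mset H. (modal_depth \<circ> snd) ` set_mset \<Gamma>). k \<le> n"
    unfolding finite_nat_set_iff_bounded_le by blast
  then show ?thesis
    by (auto simp: depth_le_def)
qed

definition seq_rank :: "'v sequent \<Rightarrow> nat" where
  "seq_rank \<Gamma> = (\<Sum>p\<in>#\<Gamma>. rank (snd p))"

lemma seq_rank_simps [simp]:
  "seq_rank {#} = 0"
  "seq_rank (add_mset p \<Gamma>) = rank (snd p) + seq_rank \<Gamma>"
  "seq_rank (\<Gamma> + \<Delta>) = seq_rank \<Gamma> + seq_rank \<Delta>"
  by (simp_all add: seq_rank_def)

lemma seq_rank_scale [simp]: "seq_rank (scale_sequent r \<Gamma>) = seq_rank \<Gamma>"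
  by (induction \<Gamma>) auto

lemma seq_rank_weigh: "rank A = 0 \<Longrightarrow> seq_rank (weigh rs A) = 0"
  by (induction rs) auto

lemma seq_rank_dia [simp]: "seq_rank (dia_sequent \<Gamma>) = 0"
  by (induction \<Gamma>) auto

section \<open>Sequents of literals, constants and modal terms\<close>

text \<open>In rank 0 the preorder of \<open>T\<close> is never consulted.\<close>

lemma sval_basic:
  assumes "seq_rank \<Gamma> = 0"
  shows "sval T \<Gamma> = sval {} \<Gamma>"
  using assms
proof (induction \<Gamma>)
  case (add p \<Gamma>)
  obtain r A where p: "p = (r, A)"
    by force
  have "val T A = val {} A"
    using add.prems p by (cases A) auto
  with add show ?case
    by (simp add: p)
qed simp

definition literals :: "'v sequent \<Rightarrow> bool" where
  "literals \<Xi> \<longleftrightarrow> (\<forall>p\<in>#\<Xi>. \<exists>x. snd p = Var x \<or> snd p = CoVar x)"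

text \<open>Isolates the shape of a conclusion of \<diamond>; the literals \<open>\<Xi>\<close> are
  what ID has to add afterwards.\<close>

lemma basic_decompose:
  assumes "seq_rank \<Gamma> = 0"
  shows "\<exists>\<Delta> rs ss \<Xi>. \<Gamma> = dia_sequent \<Delta> + weigh rs One + weigh ss CoOne + \<Xi> \<and> literals \<Xi>"
  using assms
proof (induction \<Gamma>)
  case empty
  show ?case
    by (intro exI[of _ "{#}"] exI[of _ "[]"]) (simp add: literals_def)
next
  case (add p \<Gamma>)
  then obtain \<Delta> rs ss \<Xi> where *:
    "\<Gamma> = dia_sequent \<Delta> + weigh rs One + weigh ss CoOne + \<Xi>" "literals \<Xi>"
    by auto
  obtain r A where p: "p = (r, A)"
    by force
  from add.prems show ?case
  proof (cases A)
    case One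
    with * show ?thesis
      by (intro exI[of _ \<Delta>] exI[of _ "r # rs"] exI[of _ ss] exI[of _ \<Xi>]) (simp add: p)
  next
    case CoOne
    with * show ?thesis
      by (intro exI[of _ \<Delta>] exI[of _ rs] exI[of _ "r # ss"] exI[of _ \<Xi>]) (simp add: p)
  next
    case (Dia B)
    with * show ?thesis
      by (intro exI[of _ "add_mset (r, B) \<Delta>"] exI[of _ rs] exI[of _ ss] exI[of _ \<Xi>]) (simp add: p)
  next
    case (Var x)
    with * show ?thesis
      by (intro exI[of _ \<Delta>] exI[of _ rs] exI[of _ ss] exI[of _ "add_mset p \<Xi>"])
        (simp add: p literals_def)
  next
    case (CoVar x)
    with * show ?thesis
      by (intro exI[of _ \<Delta>] exI[of _ rs] exI[of _ ss] exI[of _ "add_mset p \<Xi>"])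
        (simp add: p literals_def)
  qed (simp_all add: p)
qed

text \<open>The rule ID introduces all copies of a literal as one weight list, so scattered
  occurrences are collected first.\<close>

lemma filter_eq_weigh: "\<exists>rs. filter_mset (\<lambda>p. snd p = A) \<Gamma> = weigh rs A"
proof (induction \<Gamma>)
  case empty
  show ?case
    by (intro exI[of _ "[]"]) simp
next
  case (add p \<Gamma>)
  then obtain rs where "filter_mset (\<lambda>p. snd p = A) \<Gamma> = weigh rs A"
    by blast
  then show ?case
    by (cases p) (auto intro: exI[of _ "fst p # rs"] exI[of _ rs])
qed

lemmas pointwise = plus_fun_apply zero_fun_apply scaleR_fun_apply unit_at_apply

lemma sval_absent_Var:
  assumes "literals \<Xi>" "\<forall>p\<in>#\<Xi>. snd p \<noteq> Var x \<and> snd p \<noteq> CoVar x"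
  shows "sval T \<Xi> (Var x) = 0"
  using assms
proof (induction \<Xi>)
  case (add p \<Xi>)
  then show ?case
    by (cases p) (auto simp: pointwise literals_def split: if_splits)
qed (simp add: pointwise)

lemma sval_literals_apply:
  assumes "literals \<Xi>" "\<And>x. A \<noteq> Var x"
  shows "sval T \<Xi> A = 0"
  using assms
proof (induction \<Xi>)
  case (add p \<Xi>)
  then show ?case
    by (cases p) (auto simp: pointwise literals_def)
qed (simp add: pointwise)

text \<open>The coordinate at \<open>Var x\<close> of a vanishing value says that the weights of
  \<open>Var x\<close> and of \<open>CoVar x\<close> have equal totals, so one ID introduces all
  these occurrences; the other literals follow by induction on the size.\<close>

lemma derivable_add_literals:
  assumes "literals \<Xi>" "sval T \<Xi> = 0" "can_free_derivable (add_mset \<Gamma> G)"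
  shows "can_free_derivable (add_mset (\<Gamma> + \<Xi>) G)"
  using assms
proof (induction "size \<Xi>" arbitrary: \<Xi> \<Gamma> rule: less_induct)
  case less
  show ?case
  proof (cases "\<Xi> = {#}")
    case False
    then obtain p where p: "p \<in># \<Xi>"
      by blast
    then obtain x where x: "snd p = Var x \<or> snd p = CoVar x"
      using less.prems(1) unfolding literals_def by blast
    define R where "R = filter_mset (\<lambda>p. snd p \<noteq> Var x \<and> snd p \<noteq> CoVar x) \<Xi>"
    obtain rs where rs: "filter_mset (\<lambda>p. snd p = Var x) \<Xi> = weigh rs (Var x)"
      using filter_eq_weigh by blast
    obtain ss where ss: "filter_mset (\<lambda>p. snd p = CoVar x) \<Xi> = weigh ss (CoVar x)"
      using filter_eq_weigh by blast
    have \<Xi>: "\<Xi> = weigh rs (Var x) + weigh ss (CoVar x) + R"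
      unfolding rs[symmetric] ss[symmetric] R_def
      by (rule multiset_eqI) (simp add: count_filter_mset)
    have R: "literals R" "\<forall>p\<in>#R. snd p \<noteq> Var x \<and> snd p \<noteq> CoVar x"
      using less.prems(1) by (auto simp: R_def literals_def)
    have eq: "(total rs - total ss) *\<^sub>R unit_at (Var x) + sval T R = 0"
      using less.prems(2) by (simp add: \<Xi> scaleR_diff_left)
    from fun_cong[OF this, of "Var x"] have tot: "total rs = total ss"
      by (simp add: pointwise sval_absent_Var[OF R])
    have "size R < size \<Xi>"
      using p x unfolding R_def by (intro size_filter_unsat_elem) auto
    moreover have "sval T R = 0"
      using eq by (simp add: tot)
    moreover have "can_free_derivable (add_mset (\<Gamma> + weigh rs (Var x) + weigh ss (CoVar x)) G)"
      using tot less.prems(3) by (rule id_rule)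
    ultimately have "can_free_derivable (add_mset ((\<Gamma> + weigh rs (Var x) + weigh ss (CoVar x)) + R) G)"
      using less.hyps R(1) by blast
    then show ?thesis
      by (simp add: \<Xi> add.assoc)
  qed (use less.prems in simp)
qed

section \<open>Recovering values from under the modality\<close>

text \<open>The coordinate of the value of \<open>dia_sequent \<Gamma>\<close> at
  \<open>Dia A\<close> is the total weight of \<open>A\<close> in \<open>\<Gamma>\<close>. So the
  value with modalities determines the value without them, for every \<open>T\<close>.\<close>

lemma sval_eq_dia_sum:
  assumes "finite F" "snd ` set_mset \<Gamma> \<subseteq> F"
  shows "sval T \<Gamma> = (\<Sum>A\<in>F. sval {} (dia_sequent \<Gamma>) (Dia A) *\<^sub>R val T A)"
  using assms(2)
proof (induction \<Gamma>)
  case (add p \<Gamma>)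
  obtain r B where p: "p = (r, B)"
    by force
  have "(\<Sum>A\<in>F. sval {} (dia_sequent (add_mset p \<Gamma>)) (Dia A) *\<^sub>R val T A) =
    (\<Sum>A\<in>F. (if A = B then real_of_posreal r *\<^sub>R val T A else 0) +
      sval {} (dia_sequent \<Gamma>) (Dia A) *\<^sub>R val T A)"
    by (intro sum.cong refl) (simp add: p pointwise scaleR_add_left)
  also have "\<dots> = real_of_posreal r *\<^sub>R val T B + sval T \<Gamma>"
    using add assms(1) by (simp add: sum.distrib p)
  finally show ?case
    by (simp add: p)
qed (simp add: pointwise)

lemma sval_eqI_dia:
  assumes "\<And>A. sval {} (dia_sequent \<Gamma>) (Dia A) = sval {} (dia_sequent \<Delta>) (Dia A)"
  shows "sval T \<Gamma> = sval T \<Delta>"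
  using sval_eq_dia_sum[of "snd ` set_mset (\<Gamma> + \<Delta>)" \<Gamma> T]
    sval_eq_dia_sum[of "snd ` set_mset (\<Gamma> + \<Delta>)" \<Delta> T]
  by (simp add: assms image_Un)

lemma sval_dia_apply:
  assumes "\<And>B. A \<noteq> Dia B"
  shows "sval T (dia_sequent \<Gamma>) A = 0"
proof (induction \<Gamma>)
  case (add p \<Gamma>)
  then show ?case
    using assms by (cases p) (simp add: pointwise)
qed (simp add: pointwise)

lemma modal_cone_Var: "f \<in> modal_cone \<Longrightarrow> f (Var x) = 0"
  by (auto simp: modal_cone_def modal_premise_def sval_dia_apply pointwise fun_Compl_def)

text \<open>Membership only provides a derivable premise with the same balance of weights, which
  need not be the given sequent. Soundness makes that premise valid, and validity carries over
  because the two have equal values; derivability will come from completeness.\<close>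

lemma modal_cone_inverse:
  fixes \<Gamma> :: "'v sequent"
  assumes "sval {} (dia_sequent \<Gamma> + weigh rs One + weigh ss CoOne) \<in> modal_cone"
  shows "total ss \<le> total rs" "valid {# \<Gamma> + weigh rs One + weigh ss CoOne #}"
proof -
  from assms obtain \<Delta> ts us where
    eq: "sval {} (dia_sequent \<Gamma> + weigh rs One + weigh ss CoOne) =
      sval {} (dia_sequent \<Delta> + (weigh ts One + weigh us CoOne))"
    and le: "total us \<le> total ts"
    and der: "can_free_derivable {# \<Delta> + (weigh ts One + weigh us CoOne) #}"
    unfolding modal_cone_def modal_premise_def by blast
  \<comment> \<open>The coordinate at \<open>One\<close> sees only the difference of the totals, and
    this determines both the side condition and the contribution of the constants.\<close>
  have tot: "total rs - total ss = total ts - total us"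
    using fun_cong[OF eq, of One] by (simp add: sval_dia_apply pointwise)
  with le show "total ss \<le> total rs"
    by simp
  have "sval {} (dia_sequent \<Gamma>) (Dia A) = sval {} (dia_sequent \<Delta>) (Dia A)" for A
    using fun_cong[OF eq, of "Dia A"] by (simp add: pointwise)
  then have "sval T \<Gamma> = sval T \<Delta>" for T
    by (rule sval_eqI_dia)
  then have "sval T (\<Gamma> + weigh rs One + weigh ss CoOne) =
      sval T (\<Delta> + (weigh ts One + weigh us CoOne))" for T
    using arg_cong[OF tot, of "\<lambda>c. c *\<^sub>R (unit_at One :: 'v hterm \<Rightarrow> real)"]
    by (simp add: scaleR_diff_left add_diff_eq[symmetric])
  then show "valid {# \<Gamma> + weigh rs One + weigh ss CoOne #}"
    using soundness[OF der] by (simp add: valid_def)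
qed

text \<open>Stands for: \<open>\<Gamma>\<close> is a nonnegative combination of components of \<open>H\<close>. Quantifying over \<open>G\<close> makes
  the property closed under combinations, by splitting, scaling and contraction.\<close>

definition refines :: "'v hypersequent \<Rightarrow> 'v sequent \<Rightarrow> bool" where
  "refines H \<Gamma> \<longleftrightarrow> (\<forall>G. can_free_derivable (add_mset \<Gamma> G) \<longrightarrow> can_free_derivable (G + H))"

text \<open>Weakening supplies the other components of \<open>H\<close>.\<close>

lemma refines_component:
  assumes "\<Gamma> \<in># H"
  shows "refines H \<Gamma>"
proof -
  from assms obtain H' where H: "H = add_mset \<Gamma> H'"
    by (metis mset_add)
  show ?thesis
    unfolding refines_def
  proof (intro allI impI)
    fix G assume "can_free_derivable (add_mset \<Gamma> G)"
    then have "can_free_derivable (add_mset \<Gamma> G + H')"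
      by (rule weakening_multi) simp
    then show "can_free_derivable (G + H)"
      by (simp add: H)
  qed
qed

lemma refines_combination:
  assumes "refines H \<Gamma>" "refines H \<Delta>"
  shows "refines H (scale_sequent r \<Gamma> + scale_sequent s \<Delta>)"
  unfolding refines_def
proof (intro allI impI)
  fix G assume "can_free_derivable (add_mset (scale_sequent r \<Gamma> + scale_sequent s \<Delta>) G)"
  then have "can_free_derivable (add_mset (scale_sequent r \<Gamma>) (add_mset (scale_sequent s \<Delta>) G))"
    by (rule split_rule)
  then have "can_free_derivable (add_mset \<Gamma> (add_mset (scale_sequent s \<Delta>) G))"
    by (rule time_rule)
  then have "can_free_derivable (add_mset (scale_sequent s \<Delta>) G + H)"
    using assms(1) unfolding refines_def by blast
  then have "can_free_derivable (add_mset (scale_sequent s \<Delta>) (G + H))"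
    by simp
  then have "can_free_derivable (add_mset \<Delta> (G + H))"
    by (rule time_rule)
  then have "can_free_derivable (G + H + H)"
    using assms(2) unfolding refines_def by blast
  then show "can_free_derivable (G + H)"
    by (rule contraction_multi)
qed

text \<open>If the convex set \<open>S\<close> of values of refinements missed
  \<open>modal_cone\<close>, a total cone containing \<open>modal_cone\<close> and disjoint from
  \<open>S\<close> would contain the value of no component, against validity. Rank 0 and the depth
  bound survive scaling and sums.\<close>

lemma basic_refinement_in_modal_cone:
  fixes H :: "'v hypersequent"
  assumes "valid H" "\<And>\<Gamma>. \<Gamma> \<in># H \<Longrightarrow> seq_rank \<Gamma> = 0 \<and> depth_le n \<Gamma>"
  shows "\<exists>\<Gamma>. refines H \<Gamma> \<and> seq_rank \<Gamma> = 0 \<and> depth_le n \<Gamma> \<and> sval {} \<Gamma> \<in> modal_cone"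
proof -
  define P where "P \<Gamma> \<longleftrightarrow> refines H \<Gamma> \<and> seq_rank \<Gamma> = 0 \<and> depth_le n \<Gamma>" for \<Gamma>
  define S where "S = sval {} ` Collect P"
  have "convex S"
  proof (rule convexI)
    fix f g and u v :: real
    assume fg: "f \<in> S" "g \<in> S" and uv: "0 \<le> u" "0 \<le> v" "u + v = 1"
    from fg obtain \<Gamma> \<Delta> where *: "f = sval {} \<Gamma>" "P \<Gamma>" "g = sval {} \<Delta>" "P \<Delta>"
      unfolding S_def by blast
    show "u *\<^sub>R f + v *\<^sub>R g \<in> S"
    \<comment> \<open>Sequents are scaled by positive factors only; with a zero coefficient the
      combination is \<open>f\<close> or \<open>g\<close> itself.\<close>
    proof (cases "u = 0 \<or> v = 0")
      case True
      then show ?thesis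
        using uv fg by auto
    next
      case False
      then obtain r s where rs: "real_of_posreal r = u" "real_of_posreal s = v"
        using uv obtain_posreal by (metis less_eq_real_def)
      have "P (scale_sequent r \<Gamma> + scale_sequent s \<Delta>)"
        using *(2,4) by (simp add: P_def refines_combination)
      moreover have "u *\<^sub>R f + v *\<^sub>R g = sval {} (scale_sequent r \<Gamma> + scale_sequent s \<Delta>)"
        by (simp add: * rs)
      ultimately show ?thesis
        unfolding S_def by blast
    qed
  qed
  have "modal_cone \<inter> S \<noteq> {}"
  proof
    assume "modal_cone \<inter> S = {}"
    then obtain T where T: "total_cone T" "modal_cone \<subseteq> T" "T \<inter> S = {}"
      using exists_total_cone_disjoint[OF convex_cone_modal_cone \<open>convex S\<close>] by blast
    with assms(1) obtain \<Gamma> where \<Gamma>: "\<Gamma> \<in># H" "sval T \<Gamma> \<in> T"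
      unfolding valid_def by blast
    then have "P \<Gamma>"
      using assms(2) refines_component unfolding P_def by blast
    then have "sval {} \<Gamma> \<in> S"
      unfolding S_def by blast
    moreover have "sval T \<Gamma> = sval {} \<Gamma>"
      using assms(2)[OF \<Gamma>(1)] by (intro sval_basic) simp
    ultimately show False
      using \<Gamma>(2) T(3) by auto
  qed
  then show ?thesis
    unfolding S_def P_def by blast
qed

text \<open>The hypothesis \<open>modal\<close> supplies the premise of a \<diamond> step; ID then
  adds the literals, and \<open>refines\<close> leads from the resulting sequent to
  \<open>H\<close>.\<close>

lemma basic_completeness:
  fixes H :: "'v hypersequent"
  assumes valid: "valid H"
    and basic: "\<And>\<Gamma>. \<Gamma> \<in># H \<Longrightarrow> seq_rank \<Gamma> = 0 \<and> depth_le n \<Gamma>"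
    and modal: "\<And>(\<Gamma> :: 'v sequent) rs ss. depth_le n (dia_sequent \<Gamma>) \<Longrightarrow> total ss \<le> total rs \<Longrightarrow>
      valid {# \<Gamma> + weigh rs One + weigh ss CoOne #} \<Longrightarrow>
      can_free_derivable {# \<Gamma> + weigh rs One + weigh ss CoOne #}"
  shows "can_free_derivable H"
proof -
  from basic_refinement_in_modal_cone[OF valid basic] obtain \<Gamma> where
    \<Gamma>: "refines H \<Gamma>" "seq_rank \<Gamma> = 0" "depth_le n \<Gamma>" "sval {} \<Gamma> \<in> modal_cone"
    by blast
  from basic_decompose[OF \<Gamma>(2)] obtain \<Delta> rs ss \<Xi> where
    eq: "\<Gamma> = dia_sequent \<Delta> + weigh rs One + weigh ss CoOne + \<Xi>" and lit: "literals \<Xi>"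
    by blast
  \<comment> \<open>At variables, values in \<open>modal_cone\<close> vanish and so do the modal
    terms and constants of \<open>\<Gamma>\<close>; at every other coordinate the literals
    vanish.\<close>
  have "sval {} \<Xi> A = 0" for A
  proof (cases "\<exists>x. A = Var x")
    case True
    then show ?thesis
      using modal_cone_Var[OF \<Gamma>(4)]
      by (auto simp: eq sval_dia_apply pointwise fun_Compl_def)
  next
    case False
    then show ?thesis
      using sval_literals_apply[OF lit] by blast
  qed
  then have zero: "sval {} \<Xi> = 0"
    by (auto simp: zero_fun_apply)
  then have "sval {} (dia_sequent \<Delta> + weigh rs One + weigh ss CoOne) \<in> modal_cone"
    using \<Gamma>(4) by (simp add: eq)
  note inv = modal_cone_inverse[OF this]
  have "can_free_derivable {# \<Delta> + weigh rs One + weigh ss CoOne #}"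
    using \<Gamma>(3) inv by (intro modal) (simp_all add: eq)
  then have "can_free_derivable {# dia_sequent \<Delta> + weigh rs One + weigh ss CoOne #}"
    using inv(1) by (intro dia_rule)
  then have "can_free_derivable {# \<Gamma> #}"
    unfolding eq by (rule derivable_add_literals[OF lit zero])
  \<comment> \<open>The side hypersequent in \<open>refines\<close> is taken to be empty.\<close>
  then show ?thesis
    using \<Gamma>(1) unfolding refines_def by (metis add_0)
qed

text \<open>The base 3 makes this measure decrease although the premise of the rule for joins has two copies of
  the context.\<close>

definition hyper_rank :: "'v hypersequent \<Rightarrow> nat" where
  "hyper_rank H = (\<Sum>\<Gamma>\<in>#H. 3 ^ seq_rank \<Gamma>)"

lemma hyper_rank_add_mset [simp]: "hyper_rank (add_mset \<Gamma> H) = 3 ^ seq_rank \<Gamma> + hyper_rank H"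
  by (simp add: hyper_rank_def)

lemma join_rank_less: "(3::nat) ^ (a + g) + 3 ^ (b + g) < 3 ^ Suc (a + b + g)"
proof -
  have "(3::nat) ^ (a + g) \<le> 3 ^ (a + b + g)" "(3::nat) ^ (b + g) \<le> 3 ^ (a + b + g)"
    by (intro power_increasing; simp)+
  moreover have "(0::nat) < 3 ^ (a + b + g)"
    by simp
  ultimately show ?thesis
    unfolding power_Suc by linarith
qed

text \<open>Applying the logical rules other than \<diamond> backwards lowers
  \<open>hyper_rank\<close> and keeps validity and the depth bound; once all ranks are 0, the basic
  case applies.\<close>

lemma completeness_aux:
  fixes H :: "'v hypersequent"
  assumes modal: "\<And>(\<Gamma> :: 'v sequent) rs ss. depth_le n (dia_sequent \<Gamma>) \<Longrightarrow> total ss \<le> total rs \<Longrightarrow>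
      valid {# \<Gamma> + weigh rs One + weigh ss CoOne #} \<Longrightarrow>
      can_free_derivable {# \<Gamma> + weigh rs One + weigh ss CoOne #}"
  assumes "valid H" "\<And>\<Gamma>. \<Gamma> \<in># H \<Longrightarrow> depth_le n \<Gamma>"
  shows "can_free_derivable H"
  using assms(2,3)
proof (induction "hyper_rank H" arbitrary: H rule: less_induct)
  case less
  show ?case
  proof (cases "\<forall>\<Gamma>\<in>#H. seq_rank \<Gamma> = 0")
    case True
    then show ?thesis
      using basic_completeness[OF less.prems(1) _ modal] less.prems(2) by blast
  next
    case False
    then obtain \<Gamma>' where "\<Gamma>' \<in># H" "seq_rank \<Gamma>' \<noteq> 0"
      by blast
    moreover from this obtain p where "p \<in># \<Gamma>'" "rank (snd p) \<noteq> 0"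
      by (auto simp: seq_rank_def)
    moreover obtain r A where "p = (r, A)"
      by force
    ultimately obtain \<Gamma> G where H: "H = add_mset (add_mset (r, A) \<Gamma>) G" and A: "rank A \<noteq> 0"
      by (metis mset_add snd_conv)
    have depth: "modal_depth A \<le> n" "depth_le n \<Gamma>" "\<And>\<Delta>. \<Delta> \<in># G \<Longrightarrow> depth_le n \<Delta>"
      using less.prems(2)[of "add_mset (r, A) \<Gamma>"] less.prems(2) by (auto simp: H)
    have step: "can_free_derivable H"
      if rule: "hmr_rule k ps H" "k \<in> {R_Zero, R_Plus, R_Times, R_Join, R_Meet}"
        and ps: "\<forall>p\<in>set ps. hyper_rank p < hyper_rank H \<and> (\<forall>\<Delta>\<in>#p. depth_le n \<Delta>)" for k ps
    proof (rule can_free_derivable_rule[OF rule(1)])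
      show "can_free_derivable p" if "p \<in> set ps" for p
        using less.hyps valid_premise[OF rule less.prems(1) that] ps that by blast
    qed (use rule(2) in auto)
    from A show ?thesis
    proof (cases A)
      case Zero
      have "hmr_rule R_Zero [add_mset \<Gamma> G] H"
        using hmr_rule.Zero[of \<Gamma> G "[r]"] by (simp add: H Zero)
      from step[OF this] show ?thesis
        using depth by (auto simp: H Zero)
    next
      case (Plus B C)
      have "hmr_rule R_Plus [add_mset (add_mset (r, C) (add_mset (r, B) \<Gamma>)) G] H"
        using hmr_rule.Plus[of \<Gamma> "[r]" B C G] by (simp add: H Plus)
      from step[OF this] show ?thesis
        using depth by (auto simp: H Plus ac_simps)
    next
      case (Scale s B)
      have "hmr_rule R_Times [add_mset (add_mset (s * r, B) \<Gamma>) G] H"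
        using hmr_rule.Times[of \<Gamma> s "[r]" B G] by (simp add: H Scale)
      from step[OF this] show ?thesis
        using depth by (auto simp: H Scale)
    next
      case (Join B C)
      have "hmr_rule R_Join [add_mset (add_mset (r, B) \<Gamma>) (add_mset (add_mset (r, C) \<Gamma>) G)] H"
        using hmr_rule.Join[of \<Gamma> "[r]" B C G] by (simp add: H Join)
      from step[OF this] show ?thesis
        using depth join_rank_less[of "rank B" "seq_rank \<Gamma>" "rank C"] by (auto simp: H Join)
    next
      case (Meet B C)
      have "hmr_rule R_Meet [add_mset (add_mset (r, B) \<Gamma>) G, add_mset (add_mset (r, C) \<Gamma>) G] H"
        using hmr_rule.Meet[of \<Gamma> "[r]" B G C] by (simp add: H Meet)
      \<comment> \<open>Each premise separately is at most the sum bounded by the estimate for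
        joins.\<close>
      from step[OF this] show ?thesis
        using depth join_rank_less[of "rank B" "seq_rank \<Gamma>" "rank C"] by (auto simp: H Meet)
    qed simp_all
  qed
qed

text \<open>At depth 0 nothing stands under a modality, and the premise of \<diamond> is an instance
  of the rule 1 over INIT. At depth \<open>Suc n\<close>, the premise of \<diamond> has depth at
  most \<open>n\<close> and falls under the induction hypothesis.\<close>

lemma completeness_depth:
  fixes H :: "'v hypersequent"
  assumes "valid H" "\<And>\<Gamma>. \<Gamma> \<in># H \<Longrightarrow> depth_le n \<Gamma>"
  shows "can_free_derivable H"
  using assms
proof (induction n arbitrary: H)
  case 0
  have "can_free_derivable {# \<Gamma> + weigh rs One + weigh ss CoOne #}"
    if "depth_le 0 (dia_sequent \<Gamma>)" "total ss \<le> total rs" for \<Gamma> :: "'v sequent" and rs ss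
    using that one_rule[OF that(2) init_rule] by (simp add: depth_le_dia_0)
  with 0 show ?case
    using completeness_aux by blast
next
  case (Suc n)
  have "can_free_derivable {# \<Gamma> + weigh rs One + weigh ss CoOne #}"
    if "depth_le (Suc n) (dia_sequent \<Gamma>)" "valid {# \<Gamma> + weigh rs One + weigh ss CoOne #}"
    for \<Gamma> :: "'v sequent" and rs ss
    using that by (intro Suc.IH) (auto simp: depth_le_dia_Suc depth_le_weigh)
  with Suc.prems show ?case
    using completeness_aux by blast
qed

theorem completeness: "valid H \<Longrightarrow> can_free_derivable H"
  using completeness_depth depth_le_bound by blast

section \<open>Invertibility\<close>

text \<open>The conclusion has a single component, so one point is to be separated: a value outside
  \<open>modal_cone\<close> would be missed by some total cone containing \<open>modal_cone\<close>,
  against soundness. Membership then makes the premise valid, and completeness makes it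
  derivable.\<close>

lemma dia_inversion:
  assumes "can_free_derivable {# dia_sequent \<Gamma> + weigh rs One + weigh ss CoOne #}"
  shows "can_free_derivable {# \<Gamma> + weigh rs One + weigh ss CoOne #}"
proof -
  let ?\<Delta> = "dia_sequent \<Gamma> + weigh rs One + weigh ss CoOne"
  have "sval {} ?\<Delta> \<in> modal_cone"
  proof (rule ccontr)
    assume "sval {} ?\<Delta> \<notin> modal_cone"
    then obtain T where T: "total_cone T" "modal_cone \<subseteq> T" "T \<inter> {sval {} ?\<Delta>} = {}"
      using exists_total_cone_disjoint[OF convex_cone_modal_cone convex_singleton[of "sval {} ?\<Delta>"]]
      by blast
    have "sval T ?\<Delta> \<in> T"
      using soundness[OF assms] T(1,2) by (simp add: valid_def)
    moreover have "sval T ?\<Delta> = sval {} ?\<Delta>"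
      by (intro sval_basic) (simp add: seq_rank_weigh)
    ultimately show False
      using T(3) by simp
  qed
  then show ?thesis
    by (intro completeness modal_cone_inverse(2))
qed

theorem theorem4p8:
  fixes k :: rule_name
    and ps :: "'v::countable hypersequent list"
    and c :: "'v hypersequent"
  assumes "k \<in> logical_rules"
    and "hmr_rule k ps c"
    and "can_free_derivable c"
  shows "\<forall>p \<in> set ps. can_free_derivable p"
proof (cases "k = R_Dia")
  case True
  from assms(2) show ?thesis
    unfolding True
  proof cases
    case Dia
    with assms(3) show ?thesis
      by (simp add: dia_inversion)
  qed
next
  case False
  then have "k \<in> {R_Zero, R_Plus, R_Times, R_Join, R_Meet}"
    using assms(1) by (auto simp: logical_rules_def)
  \<comment> \<open>Validity passes from the conclusion to the premises, and completeness turns it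
    back into derivability.\<close>
  then show ?thesis
    using valid_premise[OF assms(2)] soundness[OF assms(3)] completeness by blast
qed

end
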